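(* Let $G$ be a graph and let $H$ be a rooted graph with root vertex $r$. Let $H'$ be the subgraph of $H$ induced by $V(H)\setminus\{r\}$ and let $d_H(r)$ be the degree of $r$ in $H$. Then the rooted product $G\,\sharp\,H$ satisfies $$\mathrm{tww}(G\,\sharp\,H)\le\max\{\mathrm{tww}(H')+1,\ d_H(r),\ \mathrm{tww}(G)+1,\ 2\}.$$
   Context: All graphs are finite and simple (no loops or multiple edges). Twin-width. A trigraph $G$ has a vertex set $V(G)$, a set $E(G)$ of black edges and a set $R(G)$ of red edges, with $E(G)\cap R(G)=\emptyset$; a graph is a trigraph with no red edges. $N_G(v)$ is the set of vertices joined to $v$ by a black or red edge. A $d$-trigraph is a trigraph in which every vertex is incident with at most $d$ red edges. A contraction merges two distinct (not necessarily adjacent) vertices $u,v$ into a new vertex $w$: every vertex other than $u,v$ in $N_G(u)\triangle N_G(v)$ is joined to $w$ by a red edge; every $x\in N_G(u)\cap N_G(v)$ is joined to $w$ by a black edge if $ux,vx\in E(G)$ and by a red edge otherwise; all edges not incident with $u$ or $v$ are unchanged, and $u,v$ and their incident edges are removed. A $d$-sequence of an $n$-vertex graph $G$ is a sequence of $d$-trigraphs $G_n=G,G_{n-1},\dots,G_1=K_1$ with each $G_{i-1}$ obtained from $G_i$ by one contraction. The twin-width $\mathrm{tww}(G)$ is the least $d$ such that $G$ admits a $d$-sequence. Rooted product. For a graph $G$ and a graph $H$ with a distinguished root vertex $r$, $G\,\sharp\,H$ has vertex set $V(G)\times V(H)$, and $(u,i)(v,j)$ is an edge iff [$uv\in E(G)$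 and $i=j=r$] or [$u=v$ and $ij\in E(H)$]. *)

theory Defs
  imports Main
begin

record 'a trigraph =
  verts :: "'a set"
  black :: "'a set set"
  red :: "'a set set"

definition is_trigraph :: "'a trigraph \<Rightarrow> bool" where
  "is_trigraph G \<longleftrightarrow>
     finite (verts G) \<and>
     (\<forall>e \<in> black G \<union> red G. e \<subseteq> verts G \<and> card e = 2) \<and>
     black G \<inter> red G = {}"

definition is_graph :: "'a trigraph \<Rightarrow> bool" where
  "is_graph G \<longleftrightarrow> is_trigraph G \<and> red G = {}"

definition nbrs :: "'a trigraph \<Rightarrow> 'a \<Rightarrow> 'a set" where
  "nbrs G v = {x \<in> verts G. {v, x} \<in> black G \<union> red G}"

definition degree :: "'a trigraph \<Rightarrow> 'a \<Rightarrow> nat" where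
  "degree G v = card (nbrs G v)"

definition d_trigraph :: "nat \<Rightarrow> 'a trigraph \<Rightarrow> bool" where
  "d_trigraph d G \<longleftrightarrow>
     is_trigraph G \<and> (\<forall>v \<in> verts G. card {e \<in> red G. v \<in> e} \<le> d)"

definition contract :: "'a \<Rightarrow> 'a \<Rightarrow> 'a \<Rightarrow> 'a trigraph \<Rightarrow> 'a trigraph" where
  "contract u v w G =
     \<lparr> verts = insert w (verts G - {u, v}),
       black = {e \<in> black G. u \<notin> e \<and> v \<notin> e}
         \<union> {{w, x} |x. x \<in> nbrs G u \<inter> nbrs G v \<and> {u, x} \<in> black G \<and> {v, x} \<in> black G},
       red = {e \<in> red G. u \<notin> e \<and> v \<notin> e}
         \<union> {{w, x} |x. x \<in> (nbrs G u - nbrs G v) \<union> (nbrs G v - nbrs G u) \<and> x \<noteq> u \<and> x \<noteq> v}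
         \<union> {{w, x} |x. x \<in> nbrs G u \<inter> nbrs G v \<and>
                        \<not> ({u, x} \<in> black G \<and> {v, x} \<in> black G)} \<rparr>"

text \<open>
  The name \<open>w\<close> of the merged vertex is arbitrary, as long as it does not clash with a surviving
  vertex. It may be \<open>u\<close> or \<open>v\<close> again, so that the vertex type need not supply fresh names (it may
  be finite); the result is the same up to isomorphism.
\<close>
definition is_contraction :: "'a trigraph \<Rightarrow> 'a trigraph \<Rightarrow> bool" where
  "is_contraction G G' \<longleftrightarrow>
     (\<exists>u v w. u \<in> verts G \<and> v \<in> verts G \<and> u \<noteq> v \<and> w \<notin> verts G - {u, v} \<and>
              G' = contract u v w G)"

definition is_K1 :: "'a trigraph \<Rightarrow> bool" where
  "is_K1 G \<longleftrightarrow> (\<exists>x. G = \<lparr> verts = {x}, black = {}, red = {} \<rparr>)"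

text \<open>The sequence is indexed downwards, \<open>S n = G, \<dots>, S 1\<close>; other values of \<open>S\<close> are irrelevant.\<close>
definition is_d_sequence :: "nat \<Rightarrow> 'a trigraph \<Rightarrow> (nat \<Rightarrow> 'a trigraph) \<Rightarrow> bool" where
  "is_d_sequence d G S \<longleftrightarrow>
     (let n = card (verts G) in
        n \<ge> 1 \<and> S n = G \<and> is_K1 (S 1) \<and>
        (\<forall>i \<in> {1..n}. d_trigraph d (S i)) \<and>
        (\<forall>i \<in> {2..n}. is_contraction (S i) (S (i - 1))))"

text \<open>
  The graph without vertices has no \<open>d\<close>-sequence; by convention its twin-width is \<open>0\<close>.
\<close>
definition tww :: "'a trigraph \<Rightarrow> nat" where
  "tww G = (if verts G = {} then 0 else (LEAST d. \<exists>S. is_d_sequence d G S))"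

definition induced :: "'a trigraph \<Rightarrow> 'a set \<Rightarrow> 'a trigraph" where
  "induced G A =
     \<lparr> verts = verts G \<inter> A, black = {e \<in> black G. e \<subseteq> A}, red = {e \<in> red G. e \<subseteq> A} \<rparr>"

definition rooted_product :: "'a trigraph \<Rightarrow> 'b trigraph \<Rightarrow> 'b \<Rightarrow> ('a \<times> 'b) trigraph" where
  "rooted_product G H r =
     \<lparr> verts = verts G \<times> verts H,
       black = {{(u, i), (v, j)} |u i v j.
                  u \<in> verts G \<and> v \<in> verts G \<and> i \<in> verts H \<and> j \<in> verts H \<and>
                  ({u, v} \<in> black G \<and> i = r \<and> j = r \<or> u = v \<and> {i, j} \<in> black H)},
       red = {} \<rparr>"

end

theory Submission
  imports Defs "HOL-Library.Disjoint_Sets"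
begin

text \<open>
  A contraction sequence of a graph amounts to repeatedly merging parts of a partition of its
  vertices, the red neighbours of a part being the parts joined to it by some but not all pairs.
  In the rooted product, first merge every copy of \<open>H'\<close> into one part following an optimal sequence
  for \<open>H'\<close>; a part of a copy has at most one further red neighbour, its root, and a root has at most
  \<open>d\<^sub>H(r)\<close> of them. What is left is \<open>G\<close> with at most one pendant part at each root. Follow an optimal
  sequence for \<open>G\<close>, where before each merge of two roots their pendant parts are merged: pendant
  parts have at most two red neighbours, and roots only one more than in the sequence for \<open>G\<close>.
\<close>

section \<open>Partitions of a vertex set and merges of their parts\<close>

definition complete :: "'a set set \<Rightarrow> 'a set \<Rightarrow> 'a set \<Rightarrow> bool" where
  "complete E A B \<longleftrightarrow> (\<forall>a\<in>A. \<forall>b\<in>B. {a, b} \<in> E)"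

definition touches :: "'a set set \<Rightarrow> 'a set \<Rightarrow> 'a set \<Rightarrow> bool" where
  "touches E A B \<longleftrightarrow> (\<exists>a\<in>A. \<exists>b\<in>B. {a, b} \<in> E)"

definition mixed :: "'a set set \<Rightarrow> 'a set \<Rightarrow> 'a set \<Rightarrow> bool" where
  "mixed E A B \<longleftrightarrow> touches E A B \<and> \<not> complete E A B"

definition good :: "'a set set \<Rightarrow> nat \<Rightarrow> 'a set set \<Rightarrow> bool" where
  "good E d P \<longleftrightarrow> (\<forall>A\<in>P. card {B \<in> P. B \<noteq> A \<and> mixed E A B} \<le> d)"

definition merge :: "'a set \<Rightarrow> 'a set \<Rightarrow> 'a set set \<Rightarrow> 'a set set" where
  "merge A B P = insert (A \<union> B) (P - {A, B})"

definition singletons :: "'a set \<Rightarrow> 'a set set" where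
  "singletons V = (\<lambda>x. {x}) ` V"

text \<open>A lone part has no red neighbours, so the bound is imposed only before a merge. The
  length of the sequence stays implicit: each merge lowers the number of parts by one.\<close>

inductive reducible :: "'a set set \<Rightarrow> nat \<Rightarrow> 'a set set \<Rightarrow> bool" for E d where
  base: "reducible E d {X}"
| step: "reducible E d P"
    if "good E d P" "A \<in> P" "B \<in> P" "A \<noteq> B" "reducible E d (merge A B P)"

text \<open>The trigraph \<open>T\<close> is, up to the vertex names \<open>f\<close>, the quotient of the graph with edge set
  \<open>E\<close> by the partition \<open>P\<close>.\<close>
definition represents :: "'a set set \<Rightarrow> 'b trigraph \<Rightarrow> 'a set set \<Rightarrow> ('b \<Rightarrow> 'a set) \<Rightarrow> bool" where
  "represents E T P f \<longleftrightarrow>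
     is_trigraph T \<and> disjoint P \<and> {} \<notin> P \<and> bij_betw f (verts T) P \<and>
     (\<forall>x\<in>verts T. \<forall>y\<in>verts T. x \<noteq> y \<longrightarrow>
        ({x, y} \<in> black T \<longleftrightarrow> complete E (f x) (f y)) \<and>
        ({x, y} \<in> red T \<longleftrightarrow> mixed E (f x) (f y)))"

lemma complete_commute: "complete E A B \<longleftrightarrow> complete E B A"
  unfolding complete_def by (auto, (subst insert_commute, blast)+)

lemma touches_commute: "touches E A B \<longleftrightarrow> touches E B A"
  unfolding touches_def by (auto, (metis insert_commute)+)

lemma mixed_commute: "mixed E A B \<longleftrightarrow> mixed E B A"
  using complete_commute touches_commute by (metis mixed_def)

lemma complete_Un: "complete E (A \<union> B) C \<longleftrightarrow> complete E A C \<and> complete E B C"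
  by (auto simp: complete_def)

lemma touches_Un: "touches E (A \<union> B) C \<longleftrightarrow> touches E A C \<or> touches E B C"
  by (auto simp: touches_def)

text \<open>This is where nonempty parts matter: on an empty part \<open>complete\<close> is
  vacuously true, although nothing touches it.\<close>

lemma complete_imp_touches: "complete E A B \<Longrightarrow> A \<noteq> {} \<Longrightarrow> B \<noteq> {} \<Longrightarrow> touches E A B"
  by (auto simp: complete_def touches_def)

lemma partition_on_merge:
  assumes "partition_on V P" "A \<in> P" "B \<in> P"
  shows "partition_on V (merge A B P)"
proof (rule partition_onI)
  show "\<Union> (merge A B P) = V"
    using assms by (auto simp: merge_def partition_on_def)
  show "{} \<notin> merge A B P"
    using assms by (auto simp: merge_def partition_on_def)
  fix p q assume "p \<in> merge A B P" "q \<in> merge A B P" "p \<noteq> q"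
  then show "disjnt p q"
    using assms unfolding merge_def partition_on_def disjoint_def disjnt_def
    by blast
qed

lemma partition_on_singleton_sets: "partition_on V (singletons V)"
  by (simp add: singletons_def partition_on_singletons)

text \<open>A third part would be disjoint from the nonempty \<open>A\<close>. Thus a merged part is
  always new: merging lowers the number of parts, and the naming of parts by vertices stays
  injective.\<close>

lemma Un_notin_disjoint:
  assumes "disjoint P" "{} \<notin> P" "A \<in> P" "B \<in> P"
  shows "A \<union> B \<notin> P - {A, B}"
proof
  assume "A \<union> B \<in> P - {A, B}"
  then have "A \<inter> (A \<union> B) = {}"
    using assms disjointD[of P A "A \<union> B"] by auto
  then show False using assms by auto
qed

lemma card_merge:
  assumes "disjoint P" "{} \<notin> P" "finite P" "A \<in> P" "B \<in> P" "A \<noteq> B"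
  shows "Suc (card (merge A B P)) = card P"
proof -
  have "A \<union> B \<notin> P - {A, B}"
    using assms by (intro Un_notin_disjoint)
  moreover have "card (P - {A, B}) = card P - 2" and "card P \<ge> 2"
    using assms card_mono[of P "{A, B}"] by (auto simp: card_Diff_subset)
  ultimately show ?thesis using assms by (simp add: merge_def)
qed

section \<open>Trigraphs as quotients of a graph by a partition\<close>

lemma edge_in_verts: "is_trigraph T \<Longrightarrow> {x, y} \<in> black T \<union> red T \<Longrightarrow> x \<in> verts T \<and> y \<in> verts T \<and> x \<noteq> y"
  unfolding is_trigraph_def by (metis card_2_iff doubleton_eq_iff insert_subset)

lemma edge_obtain:
  assumes "is_trigraph T" "e \<in> black T \<union> red T"
  obtains x y where "e = {x, y}" "x \<in> verts T" "y \<in> verts T" "x \<noteq> y"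
  using assms unfolding is_trigraph_def by (metis card_2_iff insert_subset)

text \<open>The colour rules of a contraction are those of unions of parts: a union is complete to a
  part iff both halves are, and touches it iff one of them does. A neighbour of only one of
  \<open>u\<close>, \<open>v\<close> becomes red because, between nonempty parts, not touching
  excludes being complete.\<close>

lemma represents_contract:
  assumes R: "represents E T P f"
    and u: "u \<in> verts T" and v: "v \<in> verts T" and "u \<noteq> v" and w: "w \<notin> verts T - {u, v}"
  shows "represents E (contract u v w T) (merge (f u) (f v) P) (f(w := f u \<union> f v))"
proof -
  let ?T = "contract u v w T" and ?f = "f(w := f u \<union> f v)" and ?V = "verts T - {u, v}"
  have T: "is_trigraph T" and disj: "disjoint P" and ne: "{} \<notin> P" and bij: "bij_betw f (verts T) P"
    and blk: "\<And>x y. x \<in> verts T \<Longrightarrow> y \<in> verts T \<Longrightarrow> x \<noteq> y \<Longrightarrow> {x, y} \<in> black T \<longleftrightarrow> complete E (f x) (f y)"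
    and rd: "\<And>x y. x \<in> verts T \<Longrightarrow> y \<in> verts T \<Longrightarrow> x \<noteq> y \<Longrightarrow> {x, y} \<in> red T \<longleftrightarrow> mixed E (f x) (f y)"
    using R by (auto simp: represents_def)
  have fP: "f x \<in> P" if "x \<in> verts T" for x using bij that by (auto simp: bij_betw_def)
  have fne: "f x \<noteq> {}" if "x \<in> verts T" for x using fP that ne by metis
  note ed = edge_in_verts[OF T]
  have verts': "verts ?T = insert w ?V" by (simp add: contract_def)
  have nb: "x \<in> nbrs T y \<longleftrightarrow> touches E (f y) (f x)" if "x \<in> verts T" "y \<in> verts T" "x \<noteq> y" for x y
    using that blk[of y x] rd[of y x] complete_imp_touches[of E "f y" "f x"] fne
    by (auto simp: nbrs_def mixed_def)
  have nbv: "x \<in> verts T" if "x \<in> nbrs T y" for x y using that by (auto simp: nbrs_def)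
  have nbn: "x \<noteq> y" if "x \<in> nbrs T y" for x y using that ed by (auto simp: nbrs_def)
  have oldb: "{x, y} \<in> black ?T \<longleftrightarrow> {x, y} \<in> black T" if "x \<in> ?V" "y \<in> ?V" for x y
    using that w by (auto simp: contract_def doubleton_eq_iff)
  have oldr: "{x, y} \<in> red ?T \<longleftrightarrow> {x, y} \<in> red T" if "x \<in> ?V" "y \<in> ?V" for x y
    using that w by (auto simp: contract_def doubleton_eq_iff)
  \<comment> \<open>Edges created at \<open>w\<close> never coincide with surviving ones: a
    surviving edge avoids \<open>u\<close> and \<open>v\<close>, so having \<open>w\<close> as an
    endpoint would contradict the choice of \<open>w\<close>.\<close>
  have wold: "{w, x} \<notin> {e \<in> black T \<union> red T. u \<notin> e \<and> v \<notin> e}" for x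
    using ed w by blast
  have newb: "{w, x} \<in> black ?T \<longleftrightarrow> complete E (f u \<union> f v) (f x)" if x: "x \<in> ?V" for x
  proof -
    have "{w, x} \<in> black ?T \<longleftrightarrow> x \<in> nbrs T u \<inter> nbrs T v \<and> {u, x} \<in> black T \<and> {v, x} \<in> black T"
      using wold[of x] x w by (auto simp: contract_def doubleton_eq_iff)
    also have "\<dots> \<longleftrightarrow> {u, x} \<in> black T \<and> {v, x} \<in> black T"
      using x by (auto simp: nbrs_def)
    also have "\<dots> \<longleftrightarrow> complete E (f u \<union> f v) (f x)"
      using x u v blk by (auto simp: complete_Un)
    finally show ?thesis .
  qed
  have newr: "{w, x} \<in> red ?T \<longleftrightarrow> mixed E (f u \<union> f v) (f x)" if x: "x \<in> ?V" for x
  proof -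
    have "{w, x} \<in> red ?T \<longleftrightarrow>
        (x \<in> (nbrs T u - nbrs T v) \<union> (nbrs T v - nbrs T u) \<or>
         x \<in> nbrs T u \<inter> nbrs T v \<and> \<not> ({u, x} \<in> black T \<and> {v, x} \<in> black T))"
      using wold[of x] x w by (auto simp: contract_def doubleton_eq_iff)
    also have "\<dots> \<longleftrightarrow> mixed E (f u \<union> f v) (f x)"
      using x u v nb[of x u] nb[of x v] blk[of u x] blk[of v x]
        complete_imp_touches[of E "f u" "f x"] complete_imp_touches[of E "f v" "f x"] fne
      by (auto simp: mixed_def complete_Un touches_Un)
    finally show ?thesis .
  qed
  \<comment> \<open>No edge is a loop at \<open>w\<close>, so every edge has an endpoint that
    survives from \<open>T\<close>. Colours are compared first for pairs of this shape; symmetry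
    gives the rest.\<close>
  have form: "\<exists>x y. e = {x, y} \<and> x \<in> insert w ?V \<and> y \<in> ?V \<and> x \<noteq> y" if "e \<in> black ?T \<union> red ?T" for e
  proof -
    from that consider "e \<in> black T \<union> red T" "u \<notin> e" "v \<notin> e"
      | x where "e = {w, x}" "x \<in> nbrs T u \<union> nbrs T v" "x \<noteq> u" "x \<noteq> v"
      using nbn unfolding contract_def by fastforce
    then show ?thesis
    proof cases
      case 1
      obtain x y where "e = {x, y}" "x \<in> verts T" "y \<in> verts T" "x \<noteq> y"
        by (rule edge_obtain[OF T 1(1)])
      then show ?thesis using 1 by blast
    next
      case 2
      then show ?thesis using nbv w by blast
    qed
  qed
  have inP: "f u \<in> P" "f v \<in> P" using u v fP by auto
  have inj: "inj_on f (verts T)" and im: "f ` verts T = P" using bij by (auto simp: bij_betw_def)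
  have cases: "({x, y} \<in> black ?T \<longleftrightarrow> complete E (?f x) (?f y)) \<and>
      ({x, y} \<in> red ?T \<longleftrightarrow> mixed E (?f x) (?f y))"
    if "x \<in> insert w ?V" "y \<in> ?V" "x \<noteq> y" for x y
  proof (cases "x = w")
    case True
    then show ?thesis using that newb[of y] newr[of y] by simp
  next
    case False
    then have "x \<in> ?V" "y \<noteq> w" using that w by auto
    then show ?thesis using that False oldb[of x y] oldr[of x y] blk[of x y] rd[of x y] by simp
  qed
  have cases': "({x, y} \<in> black ?T \<longleftrightarrow> complete E (?f x) (?f y)) \<and>
      ({x, y} \<in> red ?T \<longleftrightarrow> mixed E (?f x) (?f y))"
    if "x \<in> insert w ?V" "y \<in> insert w ?V" "x \<noteq> y" for x y
  proof (cases "y = w")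
    case True
    then show ?thesis
      using that cases[of y x] complete_commute[of E "?f x"] mixed_commute[of E "?f x"]
      by (auto simp: insert_commute)
  next
    case False
    then show ?thesis using that cases[of x y] by blast
  qed
  have "is_trigraph ?T"
    unfolding is_trigraph_def
  proof (intro conjI ballI)
    show "finite (verts ?T)" using T by (simp add: verts' is_trigraph_def)
    fix e assume "e \<in> black ?T \<union> red ?T"
    then show "e \<subseteq> verts ?T" "card e = 2" using form[of e] verts' by auto
  next
    show "black ?T \<inter> red ?T = {}"
    proof (rule ccontr)
      assume "black ?T \<inter> red ?T \<noteq> {}"
      then obtain e where e: "e \<in> black ?T" "e \<in> red ?T" by auto
      then obtain x y where "e = {x, y}" "x \<in> insert w ?V" "y \<in> ?V" "x \<noteq> y" using form[of e] by auto
      then show False using cases[of x y] e by (auto simp: mixed_def)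
    qed
  qed
  \<comment> \<open>\<open>represents\<close> fixes no ground set; the union of the parts serves as
    one.\<close>
  moreover have "partition_on (\<Union>P) (merge (f u) (f v) P)"
    using partition_on_merge[of "\<Union>P" P] disj ne inP by (simp add: partition_on_def)
  moreover have "bij_betw ?f (verts ?T) (merge (f u) (f v) P)"
  proof -
    have fV: "?f ` ?V = P - {f u, f v}"
    proof -
      have "?f ` ?V = f ` ?V" using w by auto
      also have "\<dots> = P - {f u, f v}"
        using inj_on_image_set_diff[OF inj, of "verts T" "{u, v}"] u v im by auto
      finally show ?thesis .
    qed
    have "inj_on ?f ?V"
      using inj w by (auto simp: inj_on_def)
    moreover have "f u \<union> f v \<notin> P - {f u, f v}"
      using disj ne inP by (intro Un_notin_disjoint)
    ultimately show ?thesis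
      using fV w by (auto simp: bij_betw_def verts' merge_def)
  qed
  ultimately show ?thesis
    using cases' by (simp add: represents_def partition_on_def verts')
qed

text \<open>Red edges at \<open>x\<close> correspond to their other ends, and these, under the
  injective \<open>f\<close>, to the mixed parts, so both counts equal the size of the same vertex
  set.\<close>

lemma d_trigraph_iff_good:
  assumes "represents E T P f"
  shows "d_trigraph d T \<longleftrightarrow> good E d P"
proof -
  have T: "is_trigraph T" and inj: "inj_on f (verts T)" and im: "f ` verts T = P"
    and rd: "\<And>x y. x \<in> verts T \<Longrightarrow> y \<in> verts T \<Longrightarrow> x \<noteq> y \<Longrightarrow> {x, y} \<in> red T \<longleftrightarrow> mixed E (f x) (f y)"
    using assms by (auto simp: represents_def bij_betw_def)
  have "card {e \<in> red T. x \<in> e} = card {B \<in> P. B \<noteq> f x \<and> mixed E (f x) B}" if x: "x \<in> verts T" for x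
  proof -
    let ?N = "{y \<in> verts T. {x, y} \<in> red T}"
    have "{e \<in> red T. x \<in> e} = (\<lambda>y. {x, y}) ` ?N"
    proof (intro subset_antisym subsetI)
      fix e assume e: "e \<in> {e \<in> red T. x \<in> e}"
      then have "e \<in> black T \<union> red T" by simp
      then obtain a b where "e = {a, b}" "a \<in> verts T" "b \<in> verts T"
        by (rule edge_obtain[OF T])
      with e show "e \<in> (\<lambda>y. {x, y}) ` ?N" by (auto simp: insert_commute)
    qed auto
    moreover have "inj_on (\<lambda>y. {x, y}) ?N" by (auto simp: inj_on_def doubleton_eq_iff)
    moreover have "{B \<in> P. B \<noteq> f x \<and> mixed E (f x) B} = f ` ?N"
    proof -
      have "f y \<noteq> f x \<and> mixed E (f x) (f y) \<longleftrightarrow> {x, y} \<in> red T" if "y \<in> verts T" for y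
        using that x rd[of x y] inj_on_eq_iff[OF inj] edge_in_verts[OF T, of x y] by auto
      then show ?thesis unfolding im[symmetric] by blast
    qed
    moreover have "inj_on f ?N" using inj by (rule inj_on_subset) auto
    ultimately show ?thesis by (simp add: card_image)
  qed
  then show ?thesis using T im by (auto simp: d_trigraph_def good_def)
qed

section \<open>Contraction sequences as sequences of merges, and twin-width\<close>

lemma represents_singletons:
  assumes "is_graph G"
  shows "represents (black G) G (singletons (verts G)) (\<lambda>x. {x})"
  using assms partition_on_singleton_sets[of "verts G"]
  by (auto simp: represents_def is_graph_def partition_on_def bij_betw_def singletons_def
      complete_def mixed_def touches_def)

text \<open>The sequence is read from its last trigraph upwards, so the claim concerns every tail
  \<open>S i\<close>, ..., \<open>S 1\<close>. Partition and naming vary in the induction because a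
  contraction changes both.\<close>

lemma sequence_imp_reducible:
  fixes i :: nat
  assumes "is_K1 (S 1)" "\<And>j. j \<in> {1..i} \<Longrightarrow> d_trigraph d (S j)"
    "\<And>j. j \<in> {2..i} \<Longrightarrow> is_contraction (S j) (S (j - 1))"
    "represents E (S i) P f" "1 \<le> i"
  shows "reducible E d P"
  using assms(5,2-4)
proof (induction i arbitrary: P f rule: dec_induct)
  case base
  obtain x where "verts (S 1) = {x}" using assms(1) by (auto simp: is_K1_def)
  then have "P = {f x}" using base by (auto simp: represents_def bij_betw_def)
  then show ?case by (simp add: reducible.base)
next
  case (step i)
  have "is_contraction (S (Suc i)) (S i)" using step.prems(2)[of "Suc i"] step.hyps by auto
  then obtain u v w where uv: "u \<in> verts (S (Suc i))" "v \<in> verts (S (Suc i))" "u \<noteq> v"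
    and w: "w \<notin> verts (S (Suc i)) - {u, v}" and eq: "S i = contract u v w (S (Suc i))"
    by (auto simp: is_contraction_def)
  have "represents E (S i) (merge (f u) (f v) P) (f(w := f u \<union> f v))"
    unfolding eq by (rule represents_contract[OF step.prems(3) uv w])
  then have "reducible E d (merge (f u) (f v) P)"
    using step.IH step.prems(1,2) by auto
  moreover have "good E d P"
    using step.prems(1)[of "Suc i"] d_trigraph_iff_good[OF step.prems(3)] by auto
  moreover have "f u \<in> P" "f v \<in> P" "f u \<noteq> f v"
    using step.prems(3) uv by (auto simp: represents_def bij_betw_def inj_on_def)
  ultimately show ?case by (blast intro: reducible.step)
qed

lemma reducible_imp_sequence:
  assumes "reducible E d P" "represents E T P f"
  shows "\<exists>S. is_d_sequence d T S"
  using assms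
proof (induction arbitrary: T f rule: reducible.induct)
  case (base X)
  have "bij_betw f (verts T) {X}" using base by (simp add: represents_def)
  then have "card (verts T) = 1" using bij_betw_same_card by fastforce
  then obtain x where x: "verts T = {x}" by (auto simp: card_1_singleton_iff)
  have T: "is_trigraph T" using base by (simp add: represents_def)
  have "e \<notin> black T \<union> red T" for e
    using edge_obtain[OF T, of e] x by (metis singletonD)
  then have "black T = {}" "red T = {}" by auto
  then have "is_K1 T" using x by (cases T) (simp add: is_K1_def)
  moreover have "d_trigraph d T"
    using T \<open>red T = {}\<close> by (simp add: d_trigraph_def)
  ultimately have "is_d_sequence d T (\<lambda>_. T)"
    using x by (auto simp: is_d_sequence_def Let_def)
  then show ?case by blast
next
  case (step P A B)
  have bij: "bij_betw f (verts T) P" using step.prems by (simp add: represents_def)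
  then obtain u v where uv: "u \<in> verts T" "v \<in> verts T" "f u = A" "f v = B"
    using step.hyps by (auto simp: bij_betw_def)
  with step.hyps have "u \<noteq> v" by auto
  \<comment> \<open>The merged vertex takes the name \<open>u\<close> again, so no fresh name has to
    exist in the vertex type.\<close>
  let ?T = "contract u v u T"
  have R: "represents E ?T (merge A B P) (f(u := A \<union> B))"
    using represents_contract[OF step.prems uv(1,2) \<open>u \<noteq> v\<close>, of u] uv by simp
  then obtain S where S: "is_d_sequence d ?T S" using step.IH by blast
  have "finite (verts T)" using step.prems by (simp add: represents_def is_trigraph_def)
  then have card: "card (verts T) = Suc (card (verts ?T))"
    using uv \<open>u \<noteq> v\<close> card_mono[of "verts T" "{u, v}"]
    by (simp add: contract_def card_Diff_subset)
  let ?n = "card (verts T)"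
  have con: "is_contraction T ?T"
    using uv \<open>u \<noteq> v\<close> unfolding is_contraction_def by blast
  have dt: "d_trigraph d T" using d_trigraph_iff_good[OF step.prems] step.hyps by simp
  \<comment> \<open>\<open>S\<close> serves the contracted trigraph, which has one vertex fewer;
    \<open>T\<close> is put on top at the free index \<open>?n\<close>.\<close>
  have "is_d_sequence d T (S(?n := T))"
    using S con dt unfolding is_d_sequence_def Let_def card
    by (auto simp: le_Suc_eq)
  then show ?case by blast
qed

text \<open>No part has more red neighbours than there are parts, so merging in any order works.
  This shows that the minimum in \<open>tww\<close> is taken over a nonempty set.\<close>

lemma reducible_trivial:
  assumes "partition_on V P" "finite P" "P \<noteq> {}" "card P \<le> d"
  shows "reducible E d P"
  using assms
proof (induction "card P" arbitrary: P)
  case 0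
  then show ?case by simp
next
  case (Suc n)
  show ?case
  proof (cases "\<exists>A B. A \<in> P \<and> B \<in> P \<and> A \<noteq> B")
    case True
    then obtain A B where AB: "A \<in> P" "B \<in> P" "A \<noteq> B" by blast
    have c: "Suc (card (merge A B P)) = card P"
      using Suc.prems AB by (intro card_merge) (auto simp: partition_on_def)
    have "reducible E d (merge A B P)"
      using Suc c AB partition_on_merge[of V P A B] by (intro Suc.hyps(1)) (auto simp: merge_def)
    moreover have "good E d P"
      unfolding good_def
    proof
      fix C
      have "card {B \<in> P. B \<noteq> C \<and> mixed E C B} \<le> card P"
        using Suc.prems by (intro card_mono) auto
      then show "card {B \<in> P. B \<noteq> C \<and> mixed E C B} \<le> d" using Suc.prems by simp
    qed
    ultimately show ?thesis using AB by (blast intro: reducible.step)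
  next
    case False
    then obtain X where "P = {X}" using Suc.prems by blast
    then show ?thesis by (simp add: reducible.base)
  qed
qed

lemma d_sequence_iff_reducible:
  assumes "is_graph G" "verts G \<noteq> {}"
  shows "(\<exists>S. is_d_sequence d G S) \<longleftrightarrow> reducible (black G) d (singletons (verts G))"
proof
  assume "\<exists>S. is_d_sequence d G S"
  then obtain S where S: "is_d_sequence d G S" by blast
  then show "reducible (black G) d (singletons (verts G))"
    using sequence_imp_reducible[of S "card (verts G)" d "black G" "singletons (verts G)" "\<lambda>x. {x}"]
      represents_singletons[OF assms(1)]
    by (simp add: is_d_sequence_def Let_def)
next
  assume "reducible (black G) d (singletons (verts G))"
  then show "\<exists>S. is_d_sequence d G S"
    using reducible_imp_sequence represents_singletons[OF assms(1)] by blast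
qed

lemma tww_le:
  assumes "is_graph G" "verts G \<noteq> {}" "reducible (black G) d (singletons (verts G))"
  shows "tww G \<le> d"
  using assms d_sequence_iff_reducible[OF assms(1,2), of d] by (auto simp: tww_def intro: Least_le)

lemma reducible_tww:
  assumes "is_graph G" "verts G \<noteq> {}"
  shows "reducible (black G) (tww G) (singletons (verts G))"
proof -
  have "finite (verts G)" using assms by (simp add: is_graph_def is_trigraph_def)
  then have "reducible (black G) (card (singletons (verts G))) (singletons (verts G))"
    using assms partition_on_singleton_sets
    by (intro reducible_trivial) (auto simp: singletons_def)
  then have "\<exists>S. is_d_sequence (card (singletons (verts G))) G S"
    using d_sequence_iff_reducible[OF assms] by blast
  then have "\<exists>S. is_d_sequence (LEAST d. \<exists>S. is_d_sequence d G S) G S"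
    by (rule LeastI)
  then show ?thesis using d_sequence_iff_reducible[OF assms] assms by (simp add: tww_def)
qed

section \<open>Counting parts of a partition\<close>

lemma card_Collect_le_one:
  assumes "\<And>C D. C \<in> Q \<Longrightarrow> D \<in> Q \<Longrightarrow> R C \<Longrightarrow> R D \<Longrightarrow> C = D"
  shows "card {C \<in> Q. R C} \<le> 1"
proof (cases "{C \<in> Q. R C} = {}")
  case True
  then show ?thesis by (simp only: card.empty)
next
  case False
  then obtain C where "C \<in> Q" "R C" by blast
  then have "{C \<in> Q. R C} = {C}" using assms by blast
  then show ?thesis by simp
qed

lemma partition_on_part_eq:
  assumes "partition_on V P" "A \<in> P" "B \<in> P" "x \<in> A" "x \<in> B"
  shows "A = B"
  using assms disjointD[of P A B] unfolding partition_on_def by blast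

text \<open>Sending each element of \<open>N\<close> to its part reaches every part that meets
  \<open>N\<close>. Elements outside \<open>W\<close> go to an arbitrary value, which can only
  enlarge the image.\<close>

lemma card_touching_parts_le:
  assumes P: "partition_on W P" and "finite N"
  shows "card {A \<in> P. \<exists>i\<in>A. i \<in> N} \<le> card N"
proof -
  have "{A \<in> P. \<exists>i\<in>A. i \<in> N} \<subseteq> (\<lambda>i. THE A. A \<in> P \<and> i \<in> A) ` N"
  proof
    fix A assume "A \<in> {A \<in> P. \<exists>i\<in>A. i \<in> N}"
    then obtain i where i: "A \<in> P" "i \<in> A" "i \<in> N" by blast
    then have "(THE A. A \<in> P \<and> i \<in> A) = A"
      using partition_on_part_eq[OF P] by (intro the_equality) auto
    then show "A \<in> (\<lambda>i. THE A. A \<in> P \<and> i \<in> A) ` N" using i by blast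
  qed
  then show ?thesis using assms by (meson card_image_le card_mono finite_imageI le_trans)
qed

lemma finite_elements_partition: "partition_on V P \<Longrightarrow> finite V \<Longrightarrow> finite P"
  by (auto simp: partition_on_def intro: finite_UnionD)

section \<open>The rooted product and its edges\<close>

locale graph_and_rooted_graph =
  fixes G :: "'a trigraph" and H :: "'b trigraph" and r :: 'b
  assumes G: "is_graph G" and H: "is_graph H" and r: "r \<in> verts H"
begin

definition V where "V = verts G"

definition W where "W = verts H - {r}"

definition E where "E = black (rooted_product G H r)"

definition EW where "EW = black (induced H W)"

text \<open>The partitions of the product that occur are \<open>roots {{v} | v \<in> V} \<union> copies p\<close>, where the copy
  of \<open>H'\<close> at \<open>v\<close> is partitioned by \<open>p v\<close>, followed by \<open>roots P \<union> pendants Q\<close>, where \<open>Q\<close> is \<open>P\<close> or one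
  merge ahead of it.\<close>

definition roots :: "'a set set \<Rightarrow> ('a \<times> 'b) set set" where
  "roots P = (\<lambda>A. A \<times> {r}) ` P"

definition pendants :: "'a set set \<Rightarrow> ('a \<times> 'b) set set" where
  "pendants P = (\<lambda>A. A \<times> W) ` P"

definition copies :: "('a \<Rightarrow> 'b set set) \<Rightarrow> ('a \<times> 'b) set set" where
  "copies p = (\<Union>v\<in>V. (\<lambda>A. {v} \<times> A) ` p v)"

lemma finite_V: "finite V" and finite_W: "finite W"
  using G H by (auto simp: V_def W_def is_graph_def is_trigraph_def)

lemma edge_G: "{u, v} \<in> black G \<Longrightarrow> u \<in> V \<and> v \<in> V \<and> u \<noteq> v"
  using G edge_in_verts[of G u v] by (auto simp: is_graph_def V_def)

lemma edge_H: "{i, j} \<in> black H \<Longrightarrow> i \<in> verts H \<and> j \<in> verts H \<and> i \<noteq> j"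
  using H edge_in_verts[of H i j] by (auto simp: is_graph_def)

text \<open>Edges of \<open>G\<close> and \<open>H\<close> already have their ends in the vertex
  sets, and \<open>r\<close> is a vertex of \<open>H\<close>; only for an edge inside a copy of
  \<open>H\<close> must the index \<open>u\<close> be required to lie in \<open>V\<close>.\<close>

lemma edge_iff:
  "{(u, i), (v, j)} \<in> E \<longleftrightarrow>
     {u, v} \<in> black G \<and> i = r \<and> j = r \<or> u = v \<and> u \<in> V \<and> {i, j} \<in> black H"
  (is "_ \<longleftrightarrow> ?R")
proof
  assume "{(u, i), (v, j)} \<in> E"
  then show ?R
    by (auto simp: E_def rooted_product_def doubleton_eq_iff V_def insert_commute)
next
  assume ?R
  then show "{(u, i), (v, j)} \<in> E"
    using edge_G[of u v] edge_H[of i j] r unfolding E_def rooted_product_def V_def by auto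
qed

lemma edge_W: "i \<in> W \<Longrightarrow> j \<in> W \<Longrightarrow> {i, j} \<in> black H \<longleftrightarrow> {i, j} \<in> EW"
  by (auto simp: EW_def induced_def W_def)

lemma is_graph_rooted_product: "is_graph (rooted_product G H r)"
proof -
  have "finite (verts H)" using H by (simp add: is_graph_def is_trigraph_def)
  moreover have "e \<subseteq> V \<times> verts H \<and> card e = 2" if eE: "e \<in> E" for e
  proof -
    obtain u i v j where e: "e = {(u, i), (v, j)}"
      "u \<in> V" "v \<in> V" "i \<in> verts H" "j \<in> verts H"
      using eE unfolding E_def rooted_product_def V_def by auto
    then have "(u, i) \<noteq> (v, j)"
      using eE edge_iff[of u i v j] edge_G[of u v] edge_H[of i j] by auto
    then show ?thesis using e by auto
  qed
  ultimately show ?thesis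
    using finite_V
    by (auto simp: is_graph_def is_trigraph_def E_def V_def rooted_product_def)
qed

lemma is_graph_induced: "is_graph (induced H W)"
  using H by (auto simp: is_graph_def is_trigraph_def induced_def W_def)

section \<open>Red adjacency and red degrees in partitions of the product\<close>

lemma mixed_copies:
  assumes "A \<subseteq> W" "B \<subseteq> W" "mixed E ({u} \<times> A) ({v} \<times> B)"
  shows "u = v \<and> mixed EW A B"
proof -
  \<comment> \<open>Neither part contains a root, so an edge between them comes from
    \<open>H\<close> and stays within one copy.\<close>
  have uv: "u = v" "u \<in> V"
    using assms by (auto simp: mixed_def touches_def edge_iff W_def)
  have "{(u, i), (v, j)} \<in> E \<longleftrightarrow> {i, j} \<in> EW" if "i \<in> A" "j \<in> B" for i j
    using uv assms that edge_W[of i j] by (auto simp: edge_iff W_def)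
  then show ?thesis
    using assms uv by (auto simp: mixed_def touches_def complete_def)
qed

text \<open>Touching already forces the conclusion: edges from a root to a vertex off the roots lead
  to neighbours of \<open>r\<close> in the same copy. Both orders occur because a root is met both
  as the part whose neighbours are counted and as one of those neighbours.\<close>

lemma mixed_copy_root:
  assumes "A \<subseteq> W" "mixed E ({u} \<times> A) (B \<times> {r}) \<or> mixed E (B \<times> {r}) ({u} \<times> A)"
  shows "u \<in> B \<and> (\<exists>i\<in>A. i \<in> nbrs H r)"
proof -
  have "touches E ({u} \<times> A) (B \<times> {r})"
    using assms(2) touches_commute by (auto simp: mixed_def)
  then obtain i v where "i \<in> A" "v \<in> B" "{(u, i), (v, r)} \<in> E"
    by (auto simp: touches_def)
  moreover have "i \<noteq> r" using \<open>i \<in> A\<close> assms(1) by (auto simp: W_def)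
  ultimately show ?thesis
    using edge_H[of i r] by (auto simp: edge_iff nbrs_def insert_commute)
qed

lemma mixed_roots:
  assumes "mixed E (A \<times> {r}) (B \<times> {r})"
  shows "mixed (black G) A B"
proof -
  \<comment> \<open>\<open>H\<close> has no loop at \<open>r\<close>, so two roots are joined
    exactly as in \<open>G\<close>.\<close>
  have "{(u, r), (v, r)} \<in> E \<longleftrightarrow> {u, v} \<in> black G" for u v
    using edge_H[of r r] by (auto simp: edge_iff)
  then show ?thesis
    using assms by (auto simp: mixed_def touches_def complete_def)
qed

lemma not_mixed_singleton: "\<not> mixed F {a} {b}"
  by (auto simp: mixed_def touches_def complete_def)

text \<open>For parts of one partition the conclusion means that they coincide, so distinct pendant
  parts are never red neighbours.\<close>

lemma mixed_pendants:
  assumes "mixed E (A \<times> W) (B \<times> W)"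
  shows "A \<inter> B \<noteq> {}"
  using assms by (auto simp: mixed_def touches_def edge_iff W_def)

lemma mixed_pendant_root:
  assumes "mixed E (A \<times> W) (B \<times> {r}) \<or> mixed E (B \<times> {r}) (A \<times> W)"
  shows "A \<inter> B \<noteq> {}"
  using assms by (auto simp: mixed_def touches_def edge_iff W_def)

text \<open>The copies may be at different stages. A root is a singleton, hence not mixed with
  another root; its red neighbours are parts of its own copy that meet the neighbourhood of
  \<open>r\<close>. A part of a copy has at most \<open>t\<close> red neighbours inside the copy,
  and its root as one more.\<close>

lemma good_copies:
  assumes p: "\<And>v. v \<in> V \<Longrightarrow> partition_on W (p v) \<and> good EW t (p v)"
    and d: "t + 1 \<le> d" "degree H r \<le> d"
  shows "good E d (roots (singletons V) \<union> copies p)" (is "good E d ?Q")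
  unfolding good_def
proof
  fix X assume "X \<in> ?Q"
  have sub: "A \<subseteq> W" if "v \<in> V" "A \<in> p v" for v A
    using p that by (auto simp: partition_on_def)
  have fin: "finite (p v)" if "v \<in> V" for v
    using p that finite_W finite_elements_partition by blast
  from \<open>X \<in> ?Q\<close> consider v where "v \<in> V" "X = {v} \<times> {r}"
    | v A where "v \<in> V" "A \<in> p v" "X = {v} \<times> A"
    by (auto simp: roots_def copies_def singletons_def)
  then show "card {B \<in> ?Q. B \<noteq> X \<and> mixed E X B} \<le> d"
  proof cases
    case 1
    let ?N = "{A \<in> p v. \<exists>i\<in>A. i \<in> nbrs H r}"
    have "{B \<in> ?Q. B \<noteq> X \<and> mixed E X B} \<subseteq> (\<lambda>A. {v} \<times> A) ` ?N"
    proof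
      fix B assume B: "B \<in> {B \<in> ?Q. B \<noteq> X \<and> mixed E X B}"
      then consider u where "B = {u} \<times> {r}" | u A where "u \<in> V" "A \<in> p u" "B = {u} \<times> A"
        by (auto simp: roots_def copies_def singletons_def)
      then show "B \<in> (\<lambda>A. {v} \<times> A) ` ?N"
      proof cases
        case (1 u)
        then show ?thesis using B \<open>X = {v} \<times> {r}\<close> not_mixed_singleton[of E "(v, r)" "(u, r)"] by simp
      next
        case (2 u A)
        then show ?thesis using B \<open>X = {v} \<times> {r}\<close> mixed_copy_root[OF sub, of u A u "{v}"] by auto
      qed
    qed
    then have "card {B \<in> ?Q. B \<noteq> X \<and> mixed E X B} \<le> card ?N"
      using fin[OF \<open>v \<in> V\<close>] by (intro surj_card_le) auto
    also have "\<dots> \<le> card (nbrs H r)"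
      using p \<open>v \<in> V\<close> H
      by (intro card_touching_parts_le) (auto simp: nbrs_def is_graph_def is_trigraph_def)
    finally show ?thesis using d by (simp add: degree_def)
  next
    case 2
    let ?N = "{B \<in> p v. B \<noteq> A \<and> mixed EW A B}"
    have finN: "finite ?N" using fin[OF \<open>v \<in> V\<close>] by simp
    have "{B \<in> ?Q. B \<noteq> X \<and> mixed E X B} \<subseteq> insert ({v} \<times> {r}) ((\<lambda>A. {v} \<times> A) ` ?N)"
    proof
      fix B assume B: "B \<in> {B \<in> ?Q. B \<noteq> X \<and> mixed E X B}"
      then consider u where "B = {u} \<times> {r}" | u C where "u \<in> V" "C \<in> p u" "B = {u} \<times> C"
        by (auto simp: roots_def copies_def singletons_def)
      then show "B \<in> insert ({v} \<times> {r}) ((\<lambda>A. {v} \<times> A) ` ?N)"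
      proof cases
        case (1 u)
        then show ?thesis using B 2 mixed_copy_root[OF sub, of v A v "{u}"] by auto
      next
        case (2 u C)
        then show ?thesis
          using B \<open>v \<in> V\<close> \<open>A \<in> p v\<close> \<open>X = {v} \<times> A\<close> mixed_copies[of A C v u] sub by auto
      qed
    qed
    then have "card {B \<in> ?Q. B \<noteq> X \<and> mixed E X B} \<le> card (insert ({v} \<times> {r}) ((\<lambda>A. {v} \<times> A) ` ?N))"
      using finN by (intro card_mono) auto
    also have "\<dots> \<le> Suc (card ?N)"
      using finN by (simp add: card_insert_if card_image_le le_SucI)
    also have "\<dots> \<le> Suc t" using p[OF \<open>v \<in> V\<close>] \<open>A \<in> p v\<close> by (auto simp: good_def)
    finally show ?thesis using d by simp
  qed
qed

text \<open>The premises \<open>one\<close> and \<open>two\<close> hold when \<open>P'\<close>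
  equals \<open>P\<close> or is one merge ahead of it. A root part then has at most \<open>t\<close>
  red neighbours among the roots and one pendant; a pendant has at most two roots. Taking
  \<open>P''\<close> empty covers a product without pendant parts.\<close>

lemma good_pendants:
  assumes P: "partition_on V P" and g: "good (black G) t P" and P': "partition_on V P'"
    and one: "\<And>A. A \<in> P \<Longrightarrow> card {C \<in> P'. C \<inter> A \<noteq> {}} \<le> 1"
    and two: "\<And>C. C \<in> P' \<Longrightarrow> card {A \<in> P. C \<inter> A \<noteq> {}} \<le> 2"
    and sub: "P'' \<subseteq> P'" and d: "t + 1 \<le> d" "2 \<le> d"
  shows "good E d (roots P \<union> pendants P'')" (is "good E d ?Q")
  unfolding good_def
proof
  fix X assume "X \<in> ?Q"
  have fin: "finite P" "finite P'" using P P' finite_V finite_elements_partition by auto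
  from \<open>X \<in> ?Q\<close> consider A where "A \<in> P" "X = A \<times> {r}" | C where "C \<in> P'" "X = C \<times> W"
    using sub by (auto simp: roots_def pendants_def)
  then show "card {B \<in> ?Q. B \<noteq> X \<and> mixed E X B} \<le> d"
  proof cases
    case 1
    let ?N = "{B \<in> P. B \<noteq> A \<and> mixed (black G) A B}" and ?M = "{C \<in> P'. C \<inter> A \<noteq> {}}"
    have "{B \<in> ?Q. B \<noteq> X \<and> mixed E X B} \<subseteq> (\<lambda>B. B \<times> {r}) ` ?N \<union> (\<lambda>C. C \<times> W) ` ?M"
      using 1 sub mixed_roots mixed_pendant_root by (fastforce simp: roots_def pendants_def)
    then have "card {B \<in> ?Q. B \<noteq> X \<and> mixed E X B} \<le> card ((\<lambda>B. B \<times> {r}) ` ?N \<union> (\<lambda>C. C \<times> W) ` ?M)"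
      using fin by (intro card_mono) auto
    also have "\<dots> \<le> card ((\<lambda>B. B \<times> {r}) ` ?N) + card ((\<lambda>C. C \<times> W) ` ?M)"
      by (rule card_Un_le)
    also have "\<dots> \<le> card ?N + card ?M"
      using fin by (intro add_mono card_image_le) auto
    also have "\<dots> \<le> t + 1"
      using g 1 one[of A] by (intro add_mono) (auto simp: good_def)
    finally show ?thesis using d by simp
  next
    case 2
    let ?M = "{A \<in> P. C \<inter> A \<noteq> {}}"
    have "{B \<in> ?Q. B \<noteq> X \<and> mixed E X B} \<subseteq> (\<lambda>A. A \<times> {r}) ` ?M"
    proof
      fix B assume B: "B \<in> {B \<in> ?Q. B \<noteq> X \<and> mixed E X B}"
      then consider A where "A \<in> P" "B = A \<times> {r}" | D where "D \<in> P'" "B = D \<times> W"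
        using sub by (auto simp: roots_def pendants_def)
      then show "B \<in> (\<lambda>A. A \<times> {r}) ` ?M"
      proof cases
        case (1 A)
        then show ?thesis using B 2 mixed_pendant_root[of C A] by auto
      next
        case (2 D)
        then have "C \<inter> D \<noteq> {}" using B \<open>X = C \<times> W\<close> mixed_pendants by auto
        then have "C = D" using partition_on_part_eq[OF P'] \<open>C \<in> P'\<close> 2 by blast
        then show ?thesis using B 2 \<open>X = C \<times> W\<close> by auto
      qed
    qed
    then have "card {B \<in> ?Q. B \<noteq> X \<and> mixed E X B} \<le> card ?M"
      using fin by (intro surj_card_le) auto
    then show ?thesis using two[OF \<open>C \<in> P'\<close>] d by simp
  qed
qed

section \<open>Contracting the copies of \<open>H'\<close>\<close>

lemma merge_copies:
  assumes "u \<in> V" "partition_on W P" "p u = P" "A \<in> P" "B \<in> P"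
  shows "merge ({u} \<times> A) ({u} \<times> B) (roots R \<union> copies p) = roots R \<union> copies (p(u := merge A B P))"
proof -
  have ne: "A \<noteq> {}" "B \<noteq> {}" and sub: "A \<subseteq> W" "B \<subseteq> W"
    using assms by (auto simp: partition_on_def)
  \<comment> \<open>A product with an empty factor would forget its index. Nonempty parts ensure
    that removing the two parts removes nothing from other copies.\<close>
  have eq: "{v} \<times> C = {u} \<times> D \<longleftrightarrow> v = u \<and> C = D" if "D \<noteq> {}" for v and C D :: "'b set"
    using that by (auto simp: times_eq_iff)
  have root: "C \<times> {r} \<noteq> {u} \<times> D" if "D \<subseteq> W" "D \<noteq> {}" for C D
    using that by (auto simp: times_eq_iff W_def)
  have "roots R - {{u} \<times> A, {u} \<times> B} = roots R"
    using root ne sub by (auto simp: roots_def)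
  moreover have "copies p - {{u} \<times> A, {u} \<times> B}
      = (\<Union>v\<in>V - {u}. (\<lambda>A. {v} \<times> A) ` p v) \<union> (\<lambda>A. {u} \<times> A) ` (P - {A, B})"
  proof -
    have "(\<Union>v\<in>V - {u}. (\<lambda>A. {v} \<times> A) ` p v) - {{u} \<times> A, {u} \<times> B}
        = (\<Union>v\<in>V - {u}. (\<lambda>A. {v} \<times> A) ` p v)"
      using eq[OF ne(1)] eq[OF ne(2)] by auto
    moreover have "(\<lambda>A. {u} \<times> A) ` P - {{u} \<times> A, {u} \<times> B} = (\<lambda>A. {u} \<times> A) ` (P - {A, B})"
      using eq[OF ne(1)] eq[OF ne(2)] by auto
    moreover have "copies p = (\<Union>v\<in>V - {u}. (\<lambda>A. {v} \<times> A) ` p v) \<union> (\<lambda>A. {u} \<times> A) ` P"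
      unfolding copies_def using assms(1,3) by blast
    ultimately show ?thesis by (simp only: Un_Diff)
  qed
  moreover have "copies (p(u := merge A B P))
      = (\<Union>v\<in>V - {u}. (\<lambda>A. {v} \<times> A) ` p v) \<union> (\<lambda>A. {u} \<times> A) ` merge A B P"
    using assms(1) by (auto simp: copies_def split: if_splits)
  moreover have "{u} \<times> A \<union> {u} \<times> B = {u} \<times> (A \<union> B)" by blast
  ultimately show ?thesis by (simp add: merge_def Un_Diff)
qed

text \<open>The work left after this copy enters as the last premise. While the copy at
  \<open>u\<close> runs through a sequence for \<open>H'\<close>, the other copies stand still, so
  \<open>good_copies\<close> applies at every stage. The equation \<open>p u = P\<close> ties the
  induction over \<open>P\<close> to the family \<open>p\<close>.\<close>

lemma contract_copy:
  assumes "reducible EW t P" "partition_on W P" "u \<in> V" "p u = P"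
    and "\<And>v. v \<in> V - {u} \<Longrightarrow> partition_on W (p v) \<and> good EW t (p v)"
    and d: "t + 1 \<le> d" "degree H r \<le> d"
    and "reducible E d (roots (singletons V) \<union> copies (p(u := {W})))"
  shows "reducible E d (roots (singletons V) \<union> copies p)"
  using assms(1-5,8)
proof (induction arbitrary: p rule: reducible.induct)
  case (base X)
  then have "{W} = p u" by (auto simp: partition_on_def)
  then have "p(u := {W}) = p" by simp
  then show ?case using base by simp
next
  case (step P A B)
  let ?p = "p(u := merge A B P)"
  have AB: "{u} \<times> A \<in> copies p" "{u} \<times> B \<in> copies p"
    using step by (auto simp: copies_def)
  have ne: "{u} \<times> A \<noteq> {u} \<times> B"
    using step by (auto simp: times_eq_iff)
  have good: "good E d (roots (singletons V) \<union> copies p)"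
  proof (rule good_copies[OF _ d])
    show "partition_on W (p v) \<and> good EW t (p v)" if "v \<in> V" for v
      using that step.prems(1,3,4) step.hyps(1) by (cases "v = u") simp_all
  qed
  have "reducible E d (roots (singletons V) \<union> copies ?p)"
  proof (rule step.IH)
    show "partition_on W (merge A B P)"
      using step.prems(1) step.hyps(2,3) by (rule partition_on_merge)
    show "reducible E d (roots (singletons V) \<union> copies (?p(u := {W})))"
      using step.prems(5) by (simp only: fun_upd_upd)
  qed (use step.prems(2,4) in simp_all)
  then have red: "reducible E d (merge ({u} \<times> A) ({u} \<times> B) (roots (singletons V) \<union> copies p))"
    unfolding merge_copies[of u P p, OF step.prems(2,1,3) step.hyps(2,3)] .
  show ?case
    by (rule reducible.step[OF good UnI2[OF AB(1)] UnI2[OF AB(2)] ne red])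
qed

lemma good_whole: "good F d {X}"
proof -
  have "{B \<in> {X}. B \<noteq> X \<and> mixed F X B} = {}" by auto
  then have "card {B \<in> {X}. B \<noteq> X \<and> mixed F X B} \<le> d" by (simp only: card.empty)
  then show ?thesis by (simp only: good_def ball_simps)
qed

text \<open>Shows that a copy whose contraction has not begun respects the bound \<open>t\<close>,
  as \<open>good_whole\<close> does for a finished one.\<close>

lemma reducible_imp_good: "reducible F t P \<Longrightarrow> good F t P"
  by (cases rule: reducible.cases) (auto simp: good_whole)

text \<open>\<open>U\<close> holds the copies still to be contracted. The induction runs against
  time: from the empty set, where only \<open>last\<close> remains, up to larger sets and eventually
  all of \<open>V\<close>.\<close>

lemma contract_all_copies:
  assumes H': "reducible EW t (singletons W)" and "W \<noteq> {}"
    and d: "t + 1 \<le> d" "degree H r \<le> d"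
    and "U \<subseteq> V" and last: "reducible E d (roots (singletons V) \<union> copies (\<lambda>_. {W}))"
  shows "reducible E d (roots (singletons V) \<union> copies (\<lambda>v. if v \<in> U then singletons W else {W}))"
proof -
  have "finite U" using \<open>U \<subseteq> V\<close> finite_V by (rule finite_subset)
  then show ?thesis using \<open>U \<subseteq> V\<close>
  proof (induction U)
    case empty
    then show ?case using last by simp
  next
    case (insert u U)
    let ?p = "\<lambda>v. if v \<in> insert u U then singletons W else {W}"
    have "?p(u := {W}) = (\<lambda>v. if v \<in> U then singletons W else {W})"
      using insert.hyps by (auto simp: fun_eq_iff)
    moreover have p: "partition_on W (?p v) \<and> good EW t (?p v)" for v
      using partition_on_space[OF \<open>W \<noteq> {}\<close>] reducible_imp_good[OF H']
      by (simp add: partition_on_singleton_sets good_whole)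
    moreover have "reducible E d (roots (singletons V) \<union> copies (\<lambda>v. if v \<in> U then singletons W else {W}))"
      using insert by blast
    ultimately have "reducible E d (roots (singletons V) \<union> copies (?p(u := {W})))" by metis
    then show ?case
      using insert.prems by (intro contract_copy[of t "singletons W" u ?p d] H'
          partition_on_singleton_sets d p) simp_all
  qed
qed

section \<open>Contracting roots and pendant parts along a sequence for \<open>G\<close>\<close>

lemma merge_pendants:
  assumes "W \<noteq> {}" "A \<in> P" "B \<in> P" "partition_on V P"
  shows "merge (A \<times> W) (B \<times> W) (roots R \<union> pendants P) = roots R \<union> pendants (merge A B P)"
proof -
  have ne: "A \<noteq> {}" "B \<noteq> {}" using assms by (auto simp: partition_on_def)
  have eq: "C \<times> W = D \<times> W \<longleftrightarrow> C = D" for C D :: "'a set"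
    using \<open>W \<noteq> {}\<close> by (auto simp: times_eq_iff)
  have root: "C \<times> {r} \<noteq> D \<times> W" if "D \<noteq> {}" for C D :: "'a set"
    using that \<open>W \<noteq> {}\<close> by (auto simp: times_eq_iff W_def)
  have "roots R - {A \<times> W, B \<times> W} = roots R"
    using root ne by (auto simp: roots_def)
  moreover have "pendants P - {A \<times> W, B \<times> W} = pendants (P - {A, B})"
    using eq by (auto simp: pendants_def)
  moreover have "A \<times> W \<union> B \<times> W = (A \<union> B) \<times> W" by blast
  ultimately show ?thesis by (simp add: merge_def Un_Diff pendants_def)
qed

text \<open>\<open>Q\<close> is independent of \<open>P\<close> because two roots are merged after
  their pendants, when \<open>Q\<close> is one merge ahead.\<close>

lemma merge_roots:
  assumes "A \<in> P" "B \<in> P" "partition_on V P"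
  shows "merge (A \<times> {r}) (B \<times> {r}) (roots P \<union> pendants Q) = roots (merge A B P) \<union> pendants Q"
proof -
  have ne: "A \<noteq> {}" "B \<noteq> {}" using assms by (auto simp: partition_on_def)
  have eq: "C \<times> {r} = D \<times> {r} \<longleftrightarrow> C = D" for C D :: "'a set"
    by (auto simp: times_eq_iff)
  have pend: "C \<times> W \<noteq> D \<times> {r}" if "D \<noteq> {}" for C D :: "'a set"
    using that by (auto simp: times_eq_iff W_def)
  have "pendants Q - {A \<times> {r}, B \<times> {r}} = pendants Q"
    using pend ne by (auto simp: pendants_def)
  moreover have "roots P - {A \<times> {r}, B \<times> {r}} = roots (P - {A, B})"
    using eq by (auto simp: roots_def)
  moreover have "A \<times> {r} \<union> B \<times> {r} = (A \<union> B) \<times> {r}" by blast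
  ultimately show ?thesis by (simp add: merge_def Un_Diff roots_def)
qed

text \<open>Provides the premises \<open>one\<close> and \<open>two\<close> of
  \<open>good_pendants\<close> for the moment when the pendants of \<open>A\<close> and
  \<open>B\<close> are merged but the roots are not: \<open>A \<union> B\<close> meets just
  \<open>A\<close> and \<open>B\<close>, every other part just itself.\<close>

lemma refines_merge:
  assumes P: "partition_on V P" and AB: "A \<in> P" "B \<in> P"
  shows "C \<in> P \<Longrightarrow> card {D \<in> merge A B P. D \<inter> C \<noteq> {}} \<le> 1"
    and "D \<in> merge A B P \<Longrightarrow> card {C \<in> P. D \<inter> C \<noteq> {}} \<le> 2"
proof -
  note eq = partition_on_part_eq[OF P]
  show "card {D \<in> merge A B P. D \<inter> C \<noteq> {}} \<le> 1" if "C \<in> P"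
  proof (rule card_Collect_le_one)
    fix D D' assume "D \<in> merge A B P" "D' \<in> merge A B P" "D \<inter> C \<noteq> {}" "D' \<inter> C \<noteq> {}"
    moreover have "X = (if C = A \<or> C = B then A \<union> B else C)"
      if X: "X \<in> merge A B P" "X \<inter> C \<noteq> {}" for X
    proof -
      obtain x where "x \<in> X" "x \<in> C" using X by blast
      then show ?thesis using eq[of _ _ x] AB \<open>C \<in> P\<close> X by (auto simp: merge_def)
    qed
    ultimately show "D = D'" by metis
  qed
  show "card {C \<in> P. D \<inter> C \<noteq> {}} \<le> 2" if "D \<in> merge A B P"
  proof -
    have "{C \<in> P. D \<inter> C \<noteq> {}} \<subseteq> (if D = A \<union> B then {A, B} else {D})"
    proof
      fix C assume C: "C \<in> {C \<in> P. D \<inter> C \<noteq> {}}"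
      then obtain x where "x \<in> D" "x \<in> C" by blast
      then show "C \<in> (if D = A \<union> B then {A, B} else {D})"
        using eq[of _ _ x] AB C that by (auto simp: merge_def)
    qed
    then have "card {C \<in> P. D \<inter> C \<noteq> {}} \<le> card (if D = A \<union> B then {A, B} else {D})"
      by (intro card_mono) auto
    also have "\<dots> \<le> 2" by (simp add: card_insert_if)
    finally show ?thesis .
  qed
qed

lemma refines_self:
  assumes "partition_on V P" "A \<in> P"
  shows "card {B \<in> P. B \<inter> A \<noteq> {}} \<le> 1" "card {B \<in> P. A \<inter> B \<noteq> {}} \<le> 2"
proof -
  show "card {B \<in> P. B \<inter> A \<noteq> {}} \<le> 1"
    using partition_on_part_eq[OF assms(1)] assms(2) by (intro card_Collect_le_one) blast
  then show "card {B \<in> P. A \<inter> B \<noteq> {}} \<le> 2" by (simp add: Int_commute)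
qed

text \<open>One merge in the sequence for \<open>G\<close> becomes two, pendants first and roots
  second. In the other order the merged root could have two pendants besides \<open>t\<close> red
  roots, exceeding \<open>t + 1\<close>.\<close>

lemma contract_roots_pendants:
  assumes "reducible (black G) t P" "partition_on V P" "W \<noteq> {}" and d: "t + 1 \<le> d" "2 \<le> d"
  shows "reducible E d (roots P \<union> pendants P)"
  using assms(1,2)
proof (induction rule: reducible.induct)
  case (base X)
  then have X: "X = V" "V \<noteq> {}" by (auto simp: partition_on_def)
  \<comment> \<open>At the end two parts remain, all roots and all pendant vertices; one last merge
    joins them.\<close>
  have "reducible E d (merge (X \<times> W) (X \<times> {r}) {X \<times> {r}, X \<times> W})"
  proof -
    have "merge (X \<times> W) (X \<times> {r}) {X \<times> {r}, X \<times> W} = {X \<times> W \<union> X \<times> {r}}"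
      by (auto simp: merge_def)
    then show ?thesis by (simp add: reducible.base)
  qed
  moreover have "X \<times> W \<noteq> X \<times> {r}"
    using X \<open>W \<noteq> {}\<close> by (auto simp: times_eq_iff W_def)
  moreover have "good E d {X \<times> {r}, X \<times> W}"
    using good_pendants[OF base good_whole[of _ t] base _ _ subset_refl d] refines_self[OF base]
    by (simp add: roots_def pendants_def insert_commute)
  ultimately show ?case
    using reducible.step[of E d "{X \<times> {r}, X \<times> W}" "X \<times> W" "X \<times> {r}"]
    by (simp add: roots_def pendants_def insert_commute)
next
  case (step P A B)
  have P': "partition_on V (merge A B P)" using step by (intro partition_on_merge)
  have "good E d (roots P \<union> pendants P)"
    using good_pendants[OF step.prems step.hyps(1) step.prems _ _ subset_refl d]
      refines_self[OF step.prems] by blast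
  moreover have "reducible E d (roots P \<union> pendants (merge A B P))"
  proof (rule reducible.step)
    show "good E d (roots P \<union> pendants (merge A B P))"
      using good_pendants[OF step.prems step.hyps(1) P' _ _ subset_refl d]
        refines_merge[OF step.prems step.hyps(2,3)] by blast
    show "A \<times> {r} \<in> roots P \<union> pendants (merge A B P)" "B \<times> {r} \<in> roots P \<union> pendants (merge A B P)"
      using step by (auto simp: roots_def)
    show "A \<times> {r} \<noteq> B \<times> {r}" using step by (auto simp: times_eq_iff)
    show "reducible E d (merge (A \<times> {r}) (B \<times> {r}) (roots P \<union> pendants (merge A B P)))"
      using merge_roots[OF step.hyps(2,3) step.prems] step.IH[OF P'] by simp
  qed
  moreover have "A \<times> W \<noteq> B \<times> W" using step \<open>W \<noteq> {}\<close> by (auto simp: times_eq_iff)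
  ultimately show ?case
    using merge_pendants[OF \<open>W \<noteq> {}\<close> step.hyps(2,3) step.prems, of P] step.hyps(2,3)
    by (intro reducible.step[of E d "roots P \<union> pendants P" "A \<times> W" "B \<times> W"]) (simp_all add: pendants_def)
qed

text \<open>Serves the case that \<open>H\<close> consists of its root alone: the product is a copy
  of \<open>G\<close>, and \<open>pendants P\<close> would contribute the empty set instead of
  parts.\<close>

lemma contract_roots:
  assumes "reducible (black G) t P" "partition_on V P" and d: "t + 1 \<le> d" "2 \<le> d"
  shows "reducible E d (roots P)"
  using assms(1,2)
proof (induction rule: reducible.induct)
  case (base X)
  then show ?case by (simp add: roots_def reducible.base)
next
  case (step P A B)
  have "good E d (roots P)"
    using good_pendants[OF step.prems step.hyps(1) step.prems _ _ empty_subsetI d]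
      refines_self[OF step.prems] by (simp add: pendants_def)
  moreover have "A \<times> {r} \<noteq> B \<times> {r}" using step by (auto simp: times_eq_iff)
  moreover have "reducible E d (roots (merge A B P))"
    using step by (intro step.IH partition_on_merge)
  ultimately show ?case
    using merge_roots[OF step.hyps(2,3) step.prems, of "{}"] step.hyps(2,3)
    by (intro reducible.step[of E d "roots P" "A \<times> {r}" "B \<times> {r}"]) (simp_all add: roots_def pendants_def)
qed

section \<open>The bound on the twin-width of the product\<close>

lemma tww_rooted_product_le:
  assumes d: "tww (induced H W) + 1 \<le> d" "degree H r \<le> d" "tww G + 1 \<le> d" "2 \<le> d"
  shows "tww (rooted_product G H r) \<le> d"
proof (cases "V = {}")
  case True
  \<comment> \<open>The product has no vertices, so \<open>tww\<close> takes its conventional value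
    \<open>0\<close>.\<close>
  then show ?thesis by (simp add: tww_def rooted_product_def V_def)
next
  case False
  let ?S = "singletons (verts (rooted_product G H r))"
  have G': "reducible (black G) (tww G) (singletons V)"
    using reducible_tww[OF G] False by (simp add: V_def)
  have verts: "verts (rooted_product G H r) = V \<times> insert r W"
    using r by (auto simp: rooted_product_def V_def W_def)
  have "reducible E d ?S"
  proof (cases "W = {}")
    case True
    then have "?S = roots (singletons V)"
      unfolding verts by (auto simp: singletons_def roots_def)
    then show ?thesis
      using contract_roots[OF G' partition_on_singleton_sets d(3,4)] by simp
  next
    case False
    have "verts (induced H W) = W" by (auto simp: induced_def W_def)
    then have H': "reducible EW (tww (induced H W)) (singletons W)"
      using reducible_tww[OF is_graph_induced] False by (simp add: EW_def)
    \<comment> \<open>The two phases meet here: copies shrunk to one part each are the pendants of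
      the single vertices of \<open>G\<close>.\<close>
    have "copies (\<lambda>_. {W}) = pendants (singletons V)"
      by (auto simp: copies_def pendants_def singletons_def)
    then have "reducible E d (roots (singletons V) \<union> copies (\<lambda>_. {W}))"
      using contract_roots_pendants[OF G' partition_on_singleton_sets False d(3,4)] by simp
    from contract_all_copies[OF H' False d(1,2) subset_refl this]
    have "reducible E d (roots (singletons V) \<union> copies (\<lambda>v. if v \<in> V then singletons W else {W}))" .
    moreover have "roots (singletons V) \<union> copies (\<lambda>v. if v \<in> V then singletons W else {W}) = ?S"
      unfolding verts by (auto simp: copies_def roots_def singletons_def image_iff)
    ultimately show ?thesis by simp
  qed
  then show ?thesis
    using tww_le[OF is_graph_rooted_product] False verts by (simp add: E_def)
qed

end

theorem theorem3p16:
  fixes G :: "'a trigraph" and H :: "'b trigraph" and r :: 'b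
  assumes "is_graph G" and "is_graph H" and "r \<in> verts H"
  shows "tww (rooted_product G H r)
    \<le> Max {tww (induced H (verts H - {r})) + 1, degree H r, tww G + 1, 2}"
proof -
  interpret graph_and_rooted_graph G H r using assms by unfold_locales
  show ?thesis by (rule tww_rooted_product_le) (auto simp: W_def)
qed

end
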